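(* For every optimal prefix-free machine $V$, the real $\Theta_V=\sum_{s\in\{0,1\}^*,\,H_V(s)<|s|}2^{-|s|}$ is a left-computable real which is weakly Chaitin random.
   Context: $\{0,1\}^*$ is the set of finite binary strings; $|s|$ is the length of $s$. A prefix-free machine is a partial recursive function $C:\{0,1\}^*\to\{0,1\}^*$ whose domain is prefix-free. $H_C(s)=\min\{|p| : C(p)=s\}$ (possibly $\infty$). A prefix-free machine $U$ is optimal if for every prefix-free machine $C$ there is $d\in\mathbb{N}$ such that for every $p\in\mathrm{Dom}\,C$ there is $q\in\mathrm{Dom}\,U$ with $U(q)=C(p)$ and $|q|\le|p|+d$. A particular optimal prefix-free machine $U$ is fixed and $H(s):=H_U(s)$. For a real $\alpha$ and $n\ge1$, $\alpha\restriction n$ denotes the first $n$ bits of the base-two expansion of $\alpha-\lfloor\alpha\rfloor$ (the expansion with infinitely many zeros). A real $\alpha$ is right-computable if there is a total recursive $f:\mathbb{N}^+\to\mathbb{Q}$ with $\alpha\le f(n)$ for all $n$ and $f(n)\to\alpha$; $\alpha$ is left-computable if $-\alpha$ is right-computable. A real $\alpha$ is weakly Chaitin random if there is $c\in\mathbb{N}$ such that $n-c\le H(\alpha\restriction n)$ for all $n\in\mathbb{N}^+$. *)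

theory Defs
  imports "HOL-Analysis.Analysis" "HOL-Library.Extended_Nat" "HOL-Library.Sublist"
begin

datatype recf =
    Zero
  | Succ
  | Proj nat
  | Comp recf "recf list"
  | Prim recf recf
  | Mini recf

inductive eval :: "recf \<Rightarrow> nat list \<Rightarrow> nat \<Rightarrow> bool" where
  eval_Zero: "eval Zero xs 0"
| eval_Succ: "eval Succ (x # xs) (Suc x)"
| eval_Proj: "i < length xs \<Longrightarrow> eval (Proj i) xs (xs ! i)"
| eval_Comp: "list_all2 (\<lambda>g y. eval g xs y) gs ys \<Longrightarrow> eval f ys z \<Longrightarrow> eval (Comp f gs) xs z"
| eval_Prim0: "eval g xs z \<Longrightarrow> eval (Prim g h) (0 # xs) z"
| eval_PrimS: "eval (Prim g h) (n # xs) y \<Longrightarrow> eval h (n # y # xs) z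
                 \<Longrightarrow> eval (Prim g h) (Suc n # xs) z"
| eval_Mini: "eval f (n # xs) 0 \<Longrightarrow> (\<forall>m<n. \<exists>y. eval f (m # xs) (Suc y))
                 \<Longrightarrow> eval (Mini f) xs n"

definition partial_recursive :: "(nat \<Rightarrow> nat option) \<Rightarrow> bool" where
  "partial_recursive \<phi> \<longleftrightarrow> (\<exists>f. \<forall>x y. \<phi> x = Some y \<longleftrightarrow> eval f [x] y)"

definition total_recursive :: "(nat \<Rightarrow> nat) \<Rightarrow> bool" where
  "total_recursive g \<longleftrightarrow> partial_recursive (\<lambda>x. Some (g x))"

text \<open>Binary strings are bool lists (True = 1). Standard bijection with nat
  (bijective base-2 numeration).\<close>
fun str_to_nat :: "bool list \<Rightarrow> nat" where
  "str_to_nat [] = 0"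
| "str_to_nat (b # bs) = 2 * str_to_nat bs + (if b then 2 else 1)"

definition partial_recursive_str :: "(bool list \<Rightarrow> bool list option) \<Rightarrow> bool" where
  "partial_recursive_str C \<longleftrightarrow>
     (\<exists>f. \<forall>s t. C s = Some t \<longleftrightarrow> eval f [str_to_nat s] (str_to_nat t))"

definition prefix_free_machine :: "(bool list \<Rightarrow> bool list option) \<Rightarrow> bool" where
  "prefix_free_machine C \<longleftrightarrow> partial_recursive_str C \<and>
     (\<forall>p \<in> dom C. \<forall>q \<in> dom C. prefix p q \<longrightarrow> p = q)"

definition Hc :: "(bool list \<Rightarrow> bool list option) \<Rightarrow> bool list \<Rightarrow> enat" where
  "Hc C s = (INF p \<in> {p. C p = Some s}. enat (length p))"

definition optimal_pfm :: "(bool list \<Rightarrow> bool list option) \<Rightarrow> bool" where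
  "optimal_pfm U \<longleftrightarrow> prefix_free_machine U \<and>
     (\<forall>C. prefix_free_machine C \<longrightarrow>
        (\<exists>d::nat. \<forall>p \<in> dom C. \<exists>q \<in> dom U. U q = C p \<and> length q \<le> length p + d))"

definition bits :: "real \<Rightarrow> nat \<Rightarrow> bool list" where
  "bits \<alpha> n = map (\<lambda>i. odd \<lfloor>2 ^ (i + 1) * frac \<alpha>\<rfloor>) [0..<n]"

definition computable_rat_seq :: "(nat \<Rightarrow> rat) \<Rightarrow> bool" where
  "computable_rat_seq f \<longleftrightarrow> (\<exists>a b c. total_recursive a \<and> total_recursive b \<and> total_recursive c \<and>
     (\<forall>n. f n = (of_nat (a n) - of_nat (b n)) / of_nat (c n + 1)))"

definition right_computable :: "real \<Rightarrow> bool" where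
  "right_computable \<alpha> \<longleftrightarrow> (\<exists>f. computable_rat_seq f \<and> (\<forall>n\<ge>1. \<alpha> \<le> real_of_rat (f n)) \<and>
     (\<lambda>n. real_of_rat (f n)) \<longlonglongrightarrow> \<alpha>)"

definition left_computable :: "real \<Rightarrow> bool" where
  "left_computable \<alpha> \<longleftrightarrow> right_computable (- \<alpha>)"

definition weakly_Chaitin_random :: "(bool list \<Rightarrow> bool list option) \<Rightarrow> real \<Rightarrow> bool" where
  "weakly_Chaitin_random U \<alpha> \<longleftrightarrow> (\<exists>c::nat. \<forall>n\<ge>1. enat n \<le> Hc U (bits \<alpha> n) + enat c)"

definition Theta :: "(bool list \<Rightarrow> bool list option) \<Rightarrow> real" where
  "Theta V = infsum (\<lambda>s. (1/2::real) ^ length s) {s. Hc V s < enat (length s)}"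

end

theory Submission
  imports Defs
begin

text \<open>The strings with \<open>H\<^sub>V(s) < |s|\<close> can be enumerated, so the partial sums of \<open>\<Theta>\<^sub>V\<close>
  over the strings found so far are rational approximations from below; they are bounded by Kraft's
  inequality. For randomness, take the first \<open>n\<close> bits of \<open>\<Theta>\<^sub>V\<close> and run the
  enumeration until its mass is within \<open>2\<^bsup>1-n\<^esup>\<close> of \<open>\<Theta>\<^sub>V\<close>. Any string of length \<open>n - 1\<close> still missing at
  that stage would, if compressible, contribute \<open>2\<^bsup>1-n\<^esup>\<close> more, so it satisfies \<open>H\<^sub>V(s) \<ge> n - 1\<close>, and such a
  string exists. Hence a recursive function maps \<open>\<Theta>\<^sub>V\<restriction>n\<close> to a string \<open>s\<close> with
  \<open>n - 1 \<le> H\<^sub>V(s) \<le> H\<^sub>U(\<Theta>\<^sub>V\<restriction>n) + O(1)\<close>, where the last step is optimality of \<open>V\<close> applied to the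
  composition of that function with \<open>U\<close>.\<close>

subsection \<open>Total recursive functions and decidable predicates\<close>

text \<open>Functions act on the whole argument list at a fixed arity, so that closure rules can be
  chained without currying; lists of other lengths are left unconstrained.\<close>

definition comp_fun :: "nat \<Rightarrow> (nat list \<Rightarrow> nat) \<Rightarrow> bool" where
  "comp_fun n F \<longleftrightarrow> (\<exists>f. \<forall>xs. length xs = n \<longrightarrow> eval f xs (F xs))"

definition comp_pred :: "nat \<Rightarrow> (nat list \<Rightarrow> bool) \<Rightarrow> bool" where
  "comp_pred n P \<longleftrightarrow> comp_fun n (\<lambda>xs. of_bool (P xs))"

lemma comp_fun_cong:
  assumes "comp_fun n F" and "\<And>xs. length xs = n \<Longrightarrow> G xs = F xs"
  shows "comp_fun n G"
  using assms unfolding comp_fun_def by auto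

lemma comp_fun_nth: "i < n \<Longrightarrow> comp_fun n (\<lambda>xs. xs ! i)"
  unfolding comp_fun_def by (auto intro!: exI[of _ "Proj i"] eval_Proj)

text \<open>Bounded sums and recursion bind their variables at the head of the list, so parameters
  reappear behind one or two \<open>tl\<close>.\<close>

lemma comp_fun_nth_tl: "Suc i < n \<Longrightarrow> comp_fun n (\<lambda>xs. tl xs ! i)"
  by (rule comp_fun_cong[OF comp_fun_nth[of "Suc i"]]) (auto simp: nth_tl)

lemma comp_fun_nth_tl_tl: "Suc (Suc i) < n \<Longrightarrow> comp_fun n (\<lambda>xs. tl (tl xs) ! i)"
  by (rule comp_fun_cong[OF comp_fun_nth[of "Suc (Suc i)"]]) (auto simp: nth_tl)

text \<open>\<open>Comp\<close> takes one program for each component of \<open>A\<close>. As the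
  components are arbitrary computable functions, arguments can be permuted, dropped and
  duplicated.\<close>

lemma comp_fun_subst:
  assumes F: "comp_fun k F" and len: "\<And>xs. length xs = n \<Longrightarrow> length (A xs) = k"
    and A: "\<And>j. j < k \<Longrightarrow> comp_fun n (\<lambda>xs. A xs ! j)"
  shows "comp_fun n (\<lambda>xs. F (A xs))"
proof -
  obtain f where f: "\<And>xs. length xs = k \<Longrightarrow> eval f xs (F xs)"
    using F unfolding comp_fun_def by auto
  have "\<forall>j. \<exists>g. j < k \<longrightarrow> (\<forall>xs. length xs = n \<longrightarrow> eval g xs (A xs ! j))"
    using A unfolding comp_fun_def by blast
  then obtain g where g: "\<And>j xs. j < k \<Longrightarrow> length xs = n \<Longrightarrow> eval (g j) xs (A xs ! j)"
    by metis
  have "eval (Comp f (map g [0..<k])) xs (F (A xs))" if "length xs = n" for xs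
    by (rule eval_Comp[where ys = "A xs"])
      (use that len g f in \<open>auto simp: list_all2_conv_all_nth\<close>)
  then show ?thesis unfolding comp_fun_def by blast
qed

lemma comp_fun_compose1:
  assumes "comp_fun 1 (\<lambda>xs. f (xs ! 0))" and "comp_fun n F"
  shows "comp_fun n (\<lambda>xs. f (F xs))"
  using comp_fun_subst[OF assms(1), of n "\<lambda>xs. [F xs]"] assms(2) by simp

lemma comp_fun_compose2:
  assumes "comp_fun 2 (\<lambda>xs. f (xs ! 0) (xs ! 1))" and "comp_fun n F" and "comp_fun n G"
  shows "comp_fun n (\<lambda>xs. f (F xs) (G xs))"
proof -
  have "j < 2 \<Longrightarrow> comp_fun n (\<lambda>xs. [F xs, G xs] ! j)" for j
    using assms(2,3) by (auto simp: less_2_cases_iff)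
  then show ?thesis using comp_fun_subst[OF assms(1), of n "\<lambda>xs. [F xs, G xs]"] by simp
qed

lemma comp_fun_Suc: "comp_fun n F \<Longrightarrow> comp_fun n (\<lambda>xs. Suc (F xs))"
proof (rule comp_fun_compose1[where f = Suc])
  have "eval Succ xs (Suc (xs ! 0))" if "length xs = 1" for xs
    using that eval_Succ by (cases xs) auto
  then show "comp_fun 1 (\<lambda>xs. Suc (xs ! 0))" unfolding comp_fun_def by blast
qed

lemma comp_fun_const: "comp_fun n (\<lambda>xs. c)"
proof (induction c)
  case 0
  show ?case unfolding comp_fun_def using eval_Zero by blast
qed (rule comp_fun_Suc)

lemma comp_fun_rec_nat:
  assumes "comp_fun n B" and "comp_fun n G"
    and "comp_fun (Suc (Suc n)) (\<lambda>ys. H (ys ! 0) (ys ! 1) (tl (tl ys)))"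
  shows "comp_fun n (\<lambda>xs. rec_nat (G xs) (\<lambda>m r. H m r xs) (B xs))"
proof -
  obtain g where g: "\<And>xs. length xs = n \<Longrightarrow> eval g xs (G xs)"
    using assms(2) unfolding comp_fun_def by auto
  obtain h where h: "\<And>ys. length ys = Suc (Suc n) \<Longrightarrow> eval h ys (H (ys ! 0) (ys ! 1) (tl (tl ys)))"
    using assms(3) unfolding comp_fun_def by auto
  have e: "eval (Prim g h) (m # xs) (rec_nat (G xs) (\<lambda>m r. H m r xs) m)" if "length xs = n" for m xs
  proof (induction m)
    case 0
    show ?case using g[OF that] by (simp add: eval_Prim0)
  next
    case (Suc m)
    show ?case
      using eval_PrimS[OF Suc] h[of "m # rec_nat (G xs) (\<lambda>m r. H m r xs) m # xs"] that by auto
  qed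
  have "comp_fun (Suc n) (\<lambda>ys. rec_nat (G (tl ys)) (\<lambda>m r. H m r (tl ys)) (ys ! 0))"
    unfolding comp_fun_def
  proof (intro exI allI impI)
    fix ys :: "nat list" assume "length ys = Suc n"
    then show "eval (Prim g h) ys (rec_nat (G (tl ys)) (\<lambda>m r. H m r (tl ys)) (ys ! 0))"
      using e by (cases ys) auto
  qed
  from comp_fun_subst[OF this, of n "\<lambda>xs. B xs # xs"]
  have "(\<And>j. j < Suc n \<Longrightarrow> comp_fun n (\<lambda>xs. (B xs # xs) ! j)) \<Longrightarrow> ?thesis" by simp
  moreover have "comp_fun n (\<lambda>xs. (B xs # xs) ! j)" if "j < Suc n" for j
    using that assms(1) by (cases j) (auto intro: comp_fun_nth)
  ultimately show ?thesis by blast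
qed

section \<open>Arithmetic by primitive recursion\<close>

lemma comp_fun_add:
  assumes "comp_fun n F" "comp_fun n G"
  shows "comp_fun n (\<lambda>xs. F xs + G xs)"
proof (rule comp_fun_compose2[OF _ assms])
  have "rec_nat a (\<lambda>m r. Suc r) b = a + b" for a b :: nat by (induction b) auto
  moreover have "comp_fun 2 (\<lambda>xs. rec_nat (xs ! 0) (\<lambda>m r. Suc r) (xs ! 1))"
    by (intro comp_fun_rec_nat comp_fun_Suc comp_fun_nth) auto
  ultimately show "comp_fun 2 (\<lambda>xs. xs ! 0 + xs ! 1)" by simp
qed

lemma comp_fun_mult:
  assumes "comp_fun n F" "comp_fun n G"
  shows "comp_fun n (\<lambda>xs. F xs * G xs)"
proof (rule comp_fun_compose2[OF _ assms])
  have "rec_nat 0 (\<lambda>m r. r + a) b = a * b" for a b :: nat by (induction b) auto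
  moreover have "comp_fun 2 (\<lambda>xs. rec_nat 0 (\<lambda>m r. r + xs ! 0) (xs ! 1))"
    by (intro comp_fun_rec_nat comp_fun_add comp_fun_nth comp_fun_nth_tl_tl comp_fun_const) auto
  ultimately show "comp_fun 2 (\<lambda>xs. xs ! 0 * xs ! 1)" by simp
qed

lemma comp_fun_power:
  assumes "comp_fun n F" "comp_fun n G"
  shows "comp_fun n (\<lambda>xs. F xs ^ G xs)"
proof (rule comp_fun_compose2[OF _ assms])
  have "rec_nat 1 (\<lambda>m r. r * a) b = a ^ b" for a b :: nat by (induction b) auto
  moreover have "comp_fun 2 (\<lambda>xs. rec_nat 1 (\<lambda>m r. r * xs ! 0) (xs ! 1))"
    by (intro comp_fun_rec_nat comp_fun_mult comp_fun_nth comp_fun_nth_tl_tl comp_fun_const) auto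
  ultimately show "comp_fun 2 (\<lambda>xs. xs ! 0 ^ xs ! 1)" by simp
qed

lemma comp_fun_diff:
  assumes "comp_fun n F" "comp_fun n G"
  shows "comp_fun n (\<lambda>xs. F xs - G xs)"
proof (rule comp_fun_compose2[OF _ assms])
  have pred: "rec_nat 0 (\<lambda>m r. m) a = a - 1" for a :: nat by (cases a) auto
  have "comp_fun 1 (\<lambda>xs. rec_nat 0 (\<lambda>m r. m) (xs ! 0))"
    by (intro comp_fun_rec_nat comp_fun_nth comp_fun_const) auto
  then have "comp_fun 1 (\<lambda>xs. xs ! 0 - 1)" by (simp add: pred)
  note pred_intro = comp_fun_compose1[OF this]
  have "rec_nat a (\<lambda>m r. r - 1) b = a - b" for a b :: nat by (induction b) auto
  moreover have "comp_fun 2 (\<lambda>xs. rec_nat (xs ! 0) (\<lambda>m r. r - 1) (xs ! 1))"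
    by (intro comp_fun_rec_nat pred_intro comp_fun_nth) auto
  ultimately show "comp_fun 2 (\<lambda>xs. xs ! 0 - xs ! 1)" by simp
qed

lemma comp_fun_sum:
  assumes "comp_fun n B" and "comp_fun (Suc n) (\<lambda>ys. F (ys ! 0) (tl ys))"
  shows "comp_fun n (\<lambda>xs. \<Sum>i<B xs. F i xs)"
proof -
  have eq: "(\<Sum>i<b. F i xs) = rec_nat 0 (\<lambda>m r. r + F m xs) b" for b xs
    by (induction b) auto
  \<comment> \<open>In the recursion the running total sits at position 1, between the index and the
    parameters, and the summand must skip it.\<close>
  have "comp_fun (Suc (Suc n)) (\<lambda>ys. F (ys ! 0) (tl (tl ys)))"
  proof (rule comp_fun_cong)
    show "comp_fun (Suc (Suc n)) (\<lambda>ys. (\<lambda>ys. F (ys ! 0) (tl ys)) (ys ! 0 # tl (tl ys)))"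
    proof (rule comp_fun_subst[OF assms(2)])
      fix j assume "j < Suc n"
      then show "comp_fun (Suc (Suc n)) (\<lambda>xs. (xs ! 0 # tl (tl xs)) ! j)"
        by (cases j) (auto intro: comp_fun_nth comp_fun_nth_tl_tl)
    qed auto
  qed auto
  then show ?thesis
    unfolding eq by (intro comp_fun_rec_nat assms comp_fun_add comp_fun_nth comp_fun_const) auto
qed

section \<open>Decidable predicates, bounded quantifiers and division\<close>

lemma comp_pred_le:
  assumes "comp_fun n F" "comp_fun n G"
  shows "comp_pred n (\<lambda>xs. F xs \<le> G xs)"
proof -
  have "of_bool (F xs \<le> G xs) = 1 - (F xs - G xs)" for xs by auto
  then show ?thesis unfolding comp_pred_def
    using comp_fun_diff[OF comp_fun_const[of n 1] comp_fun_diff[OF assms]] by simp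
qed

lemma comp_pred_less:
  assumes "comp_fun n F" "comp_fun n G"
  shows "comp_pred n (\<lambda>xs. F xs < G xs)"
  using comp_pred_le[OF comp_fun_Suc[OF assms(1)] assms(2)] by (simp add: Suc_le_eq)

lemma comp_pred_not:
  assumes "comp_pred n P"
  shows "comp_pred n (\<lambda>xs. \<not> P xs)"
proof -
  have "of_bool (\<not> P xs) = 1 - (of_bool (P xs) :: nat)" for xs by auto
  then show ?thesis
    using comp_fun_diff[OF comp_fun_const[of n 1] assms[unfolded comp_pred_def]]
    unfolding comp_pred_def by simp
qed

lemma comp_pred_conj:
  assumes "comp_pred n P" "comp_pred n Q"
  shows "comp_pred n (\<lambda>xs. P xs \<and> Q xs)"
  using comp_fun_mult[OF assms[unfolded comp_pred_def]] unfolding comp_pred_def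
  by (simp only: of_bool_conj)

lemma comp_pred_eq:
  assumes "comp_fun n F" "comp_fun n G"
  shows "comp_pred n (\<lambda>xs. F xs = G xs)"
  using comp_pred_conj[OF comp_pred_le[OF assms] comp_pred_le[OF assms(2,1)]]
  by (simp add: eq_iff)

lemma comp_fun_of_bool: "comp_pred n P \<Longrightarrow> comp_fun n (\<lambda>xs. of_bool (P xs))"
  by (simp add: comp_pred_def)

lemma comp_pred_ex_less:
  assumes "comp_fun n B" and "comp_pred (Suc n) (\<lambda>ys. P (ys ! 0) (tl ys))"
  shows "comp_pred n (\<lambda>xs. \<exists>i<B xs. P i xs)"
proof -
  have "(0 < (\<Sum>i<B xs. of_bool (P i xs) :: nat)) = (\<exists>i<B xs. P i xs)" for xs
  proof -
    have "(\<Sum>i<B xs. of_bool (P i xs) :: nat) = 0 \<longleftrightarrow> (\<forall>i<B xs. \<not> P i xs)" by auto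
    then show ?thesis by (metis gr0I less_irrefl)
  qed
  moreover have "comp_pred n (\<lambda>xs. 0 < (\<Sum>i<B xs. of_bool (P i xs) :: nat))"
    by (intro comp_pred_less comp_fun_const comp_fun_sum comp_fun_of_bool assms)
  ultimately show ?thesis by simp
qed

lemma comp_pred_all_less:
  assumes "comp_fun n B" and "comp_pred (Suc n) (\<lambda>ys. P (ys ! 0) (tl ys))"
  shows "comp_pred n (\<lambda>xs. \<forall>i<B xs. P i xs)"
  using comp_pred_not[OF comp_pred_ex_less[OF assms(1) comp_pred_not[OF assms(2)]]] by simp

lemma comp_fun_if:
  assumes "comp_pred n P" "comp_fun n F" "comp_fun n G"
  shows "comp_fun n (\<lambda>xs. if P xs then F xs else G xs)"
proof -
  have eq: "(if P xs then F xs else G xs) = of_bool (P xs) * F xs + of_bool (\<not> P xs) * G xs" for xs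
    by simp
  show ?thesis unfolding eq
    by (intro comp_fun_add comp_fun_mult comp_fun_of_bool comp_pred_not assms)
qed

lemma comp_fun_div:
  assumes "comp_fun n F" "comp_fun n G"
  shows "comp_fun n (\<lambda>xs. F xs div G xs)"
proof (rule comp_fun_compose2[OF _ assms])
  \<comment> \<open>For positive \<open>b\<close> the quotient counts the positive multiples of
    \<open>b\<close> up to \<open>a\<close>, of which there are at most \<open>a\<close>. Division
    by \<open>0\<close> returns \<open>0\<close> by convention.\<close>
  have eq: "a div b = (if b = 0 then 0 else \<Sum>i<a. of_bool (Suc i * b \<le> a))" for a b :: nat
  proof (cases "b = 0")
    case False
    have "{..<a} \<inter> {i. Suc i * b \<le> a} = {..<a div b}"
    proof -
      have "Suc i * b \<le> a \<longleftrightarrow> i < a div b" for i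
        using False by (metis Suc_le_eq less_eq_div_iff_mult_less_eq not_gr0)
      moreover have "i < a" if "i < a div b" for i
        using that by (meson div_le_dividend order_less_le_trans)
      ultimately show ?thesis by auto
    qed
    then show ?thesis using False by simp
  qed auto
  show "comp_fun 2 (\<lambda>xs. xs ! 0 div xs ! 1)"
    unfolding eq
    by (intro comp_fun_if comp_pred_eq comp_pred_le comp_fun_sum comp_fun_of_bool comp_fun_mult
        comp_fun_Suc comp_fun_nth comp_fun_nth_tl comp_fun_const) auto
qed

lemma comp_fun_mod:
  assumes "comp_fun n F" "comp_fun n G"
  shows "comp_fun n (\<lambda>xs. F xs mod G xs)"
  unfolding modulo_nat_def by (intro comp_fun_diff comp_fun_mult comp_fun_div assms)

lemmas comp_fun_intros = comp_fun_add comp_fun_mult comp_fun_power comp_fun_diff comp_fun_div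
  comp_fun_mod comp_fun_sum comp_fun_if comp_fun_of_bool comp_fun_Suc comp_fun_nth
  comp_fun_nth_tl comp_fun_nth_tl_tl comp_fun_const
  comp_pred_le comp_pred_less comp_pred_eq comp_pred_not comp_pred_conj comp_pred_ex_less comp_pred_all_less

subsection \<open>Evaluation with bounded search\<close>

text \<open>The result \<open>0\<close> means that no value was found and \<open>Suc y\<close> stands for the value \<open>y\<close>. The fuel
  \<open>t\<close> only limits unbounded search; as it is passed on unchanged, no coding of programs or
  computations is needed to see that \<open>bounded_eval f\<close> is recursive for each fixed \<open>f\<close>.\<close>
primrec bounded_eval :: "recf \<Rightarrow> nat \<Rightarrow> nat list \<Rightarrow> nat" where
  "bounded_eval Zero t xs = 1"
| "bounded_eval Succ t xs = (if xs = [] then 0 else Suc (Suc (hd xs)))"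
| "bounded_eval (Proj i) t xs = (if i < length xs then Suc (xs ! i) else 0)"
| "bounded_eval (Comp f gs) t xs =
     (let ys = map (\<lambda>v. v t xs) (map bounded_eval gs)
      in if 0 \<in> set ys then 0 else bounded_eval f t (map (\<lambda>y. y - 1) ys))"
| "bounded_eval (Prim g h) t xs =
     (if xs = [] then 0
      else rec_nat (bounded_eval g t (tl xs))
        (\<lambda>m r. if r = 0 then 0 else bounded_eval h t (m # (r - 1) # tl xs)) (hd xs))"
| "bounded_eval (Mini f) t xs =
     (\<Sum>n<t. if bounded_eval f t (n # xs) = 1 \<and> (\<forall>m<n. 1 < bounded_eval f t (m # xs))
            then Suc n else 0)"

text \<open>The list \<open>gs\<close> belongs to the program rather than to the input, so absence
  of \<open>0\<close> is a fixed finite conjunction, built by induction on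
  \<open>gs\<close>.\<close>

lemma comp_pred_zero_mem_map:
  assumes "\<And>g. g \<in> set gs \<Longrightarrow> comp_fun n (G g)"
  shows "comp_pred n (\<lambda>xs. 0 \<in> set (map (\<lambda>g. G g xs) gs))"
proof -
  have "comp_pred n (\<lambda>xs. 0 \<notin> set (map (\<lambda>g. G g xs) gs))" using assms
  proof (induction gs)
    case Nil
    show ?case by (simp add: comp_pred_def comp_fun_const)
  next
    case (Cons g gs)
    have "comp_pred n (\<lambda>xs. 0 < G g xs \<and> 0 \<notin> set (map (\<lambda>g. G g xs) gs))"
      using Cons by (intro comp_fun_intros Cons.IH) auto
    then show ?case by simp
  qed
  from comp_pred_not[OF this] show ?thesis by simp
qed

text \<open>Induction on the program. The fuel leads the argument list and the arity stays
  arbitrary, because \<open>Comp\<close>, \<open>Prim\<close> and \<open>Mini\<close> run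
  subprograms on argument lists of other lengths.\<close>

lemma comp_fun_bounded_eval: "comp_fun (Suc n) (\<lambda>ys. bounded_eval f (ys ! 0) (tl ys))"
proof (induction f arbitrary: n)
  case Zero
  show ?case by (simp add: comp_fun_const)
next
  case Succ
  show ?case
  proof (cases n)
    case 0
    then show ?thesis by (intro comp_fun_cong[OF comp_fun_const[of _ 0]]) (auto simp: length_Suc_conv)
  next
    case (Suc k)
    have "comp_fun (Suc n) (\<lambda>ys. Suc (Suc (ys ! 1)))" using Suc by (intro comp_fun_intros) auto
    then show ?thesis by (rule comp_fun_cong) (auto simp: length_Suc_conv Suc)
  qed
next
  case (Proj i)
  show ?case
  proof (cases "i < n")
    case True
    have "comp_fun (Suc n) (\<lambda>ys. Suc (ys ! Suc i))" using True by (intro comp_fun_intros) auto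
    then show ?thesis by (rule comp_fun_cong) (use True in \<open>auto simp: nth_tl\<close>)
  next
    case False
    show ?thesis by (rule comp_fun_cong[OF comp_fun_const[of _ 0]]) (use False in auto)
  qed
next
  case (Comp f gs)
  define G where "G g = (\<lambda>ys. bounded_eval g (ys ! 0) (tl ys))" for g
  have G: "g \<in> set gs \<Longrightarrow> comp_fun (Suc n) (G g)" for g
    unfolding G_def using Comp(2) by blast
  have "comp_fun (Suc n) (\<lambda>ys. (\<lambda>ys. bounded_eval f (ys ! 0) (tl ys)) (ys ! 0 # map (\<lambda>g. G g ys - 1) gs))"
  proof (rule comp_fun_subst[OF Comp(1)[of "length gs"]])
    fix j assume "j < Suc (length gs)"
    then show "comp_fun (Suc n) (\<lambda>xs. (xs ! 0 # map (\<lambda>g. G g xs - 1) gs) ! j)"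
    proof (cases j)
      case (Suc i)
      have "comp_fun (Suc n) (\<lambda>xs. G (gs ! i) xs - 1)"
        by (intro comp_fun_diff comp_fun_const G) (use Suc \<open>j < Suc (length gs)\<close> in simp)
      then show ?thesis using Suc \<open>j < Suc (length gs)\<close> by simp
    qed (simp add: comp_fun_nth)
  qed auto
  then have "comp_fun (Suc n) (\<lambda>ys. if 0 \<in> set (map (\<lambda>g. G g ys) gs) then 0
      else bounded_eval f (ys ! 0) (map (\<lambda>g. G g ys - 1) gs))"
    by (intro comp_fun_if comp_pred_zero_mem_map comp_fun_const G) auto
  then show ?case by (rule comp_fun_cong) (simp add: G_def Let_def comp_def)
next
  case (Prim g h)
  show ?case
  proof (cases n)
    case 0
    then show ?thesis by (intro comp_fun_cong[OF comp_fun_const[of _ 0]]) (auto simp: length_Suc_conv)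
  next
    case (Suc k)
    have g: "comp_fun (Suc n) (\<lambda>ys. (\<lambda>ys. bounded_eval g (ys ! 0) (tl ys)) (ys ! 0 # tl (tl ys)))"
    proof (rule comp_fun_subst[OF Prim(1)[of k]])
      fix j assume "j < Suc k"
      then show "comp_fun (Suc n) (\<lambda>xs. (xs ! 0 # tl (tl xs)) ! j)"
        by (cases j) (auto intro: comp_fun_intros simp: Suc)
    qed (simp add: Suc)
    \<comment> \<open>The incoming list is counter, accumulator, fuel, recursion argument,
      parameters. Fuel moves to the front and the accumulator is lowered by one, since
      \<open>Suc y\<close> encodes the value \<open>y\<close>.\<close>
    have h: "comp_fun (Suc (Suc (Suc n))) (\<lambda>ys. (\<lambda>ys. bounded_eval h (ys ! 0) (tl ys))
        (tl (tl ys) ! 0 # ys ! 0 # (ys ! 1 - 1) # tl (tl (tl (tl ys)))))"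
    proof (rule comp_fun_subst[OF Prim(2)[of "Suc n"]])
      fix j assume j: "j < Suc (Suc n)"
      let ?A = "\<lambda>xs. tl (tl xs) ! 0 # xs ! 0 # (xs ! 1 - 1) # tl (tl (tl (tl xs)))"
      consider "j = 0" | "j = 1" | "j = 2" | i where "j = Suc (Suc (Suc i))"
        by (metis One_nat_def Suc_1 not0_implies_Suc)
      then show "comp_fun (Suc (Suc (Suc n))) (\<lambda>xs. ?A xs ! j)"
      proof cases
        case (4 i)
        have "comp_fun (Suc (Suc (Suc n))) (\<lambda>xs. xs ! Suc (Suc (Suc (Suc i))))"
          using 4 j by (intro comp_fun_nth) auto
        then show ?thesis by (rule comp_fun_cong) (use 4 j in \<open>auto simp: nth_tl\<close>)
      qed (auto intro: comp_fun_intros)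
    qed (simp add: Suc)
    have "comp_fun (Suc n) (\<lambda>ys. rec_nat (bounded_eval g (ys ! 0) (tl (tl ys)))
        (\<lambda>m r. if r = 0 then 0 else bounded_eval h (ys ! 0) (m # (r - 1) # tl (tl ys))) (ys ! 1))"
      using g h by (intro comp_fun_rec_nat comp_fun_intros) (auto simp: Suc)
    then show ?thesis
      by (rule comp_fun_cong) (auto simp: Suc length_Suc_conv)
  qed
next
  case (Mini f)
  have 1: "comp_fun (Suc (Suc n)) (\<lambda>zs. bounded_eval f (tl zs ! 0) (zs ! 0 # tl (tl zs)))"
  proof -
    have "comp_fun (Suc (Suc n)) (\<lambda>zs. (\<lambda>ys. bounded_eval f (ys ! 0) (tl ys)) (tl zs ! 0 # zs ! 0 # tl (tl zs)))"
    proof (rule comp_fun_subst[OF Mini])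
      fix j assume "j < Suc (Suc n)"
      then show "comp_fun (Suc (Suc n)) (\<lambda>zs. (tl zs ! 0 # zs ! 0 # tl (tl zs)) ! j)"
        by (auto simp: less_Suc_eq_0_disj nth_Cons' intro: comp_fun_intros)
    qed simp
    then show ?thesis by simp
  qed
  have 2: "comp_fun (Suc (Suc (Suc n))) (\<lambda>zs. bounded_eval f (tl (tl zs) ! 0) (zs ! 0 # tl (tl (tl zs))))"
  proof -
    have "comp_fun (Suc (Suc (Suc n))) (\<lambda>zs. (\<lambda>zs. bounded_eval f (tl zs ! 0) (zs ! 0 # tl (tl zs))) (zs ! 0 # tl (tl zs)))"
    proof (rule comp_fun_subst[OF 1])
      fix j assume "j < Suc (Suc n)"
      then show "comp_fun (Suc (Suc (Suc n))) (\<lambda>zs. (zs ! 0 # tl (tl zs)) ! j)"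
        by (cases j) (auto intro: comp_fun_intros)
    qed simp
    then show ?thesis by simp
  qed
  have "comp_fun (Suc n) (\<lambda>ys. \<Sum>n<ys ! 0. if bounded_eval f (ys ! 0) (n # tl ys) = 1
        \<and> (\<forall>m<n. 1 < bounded_eval f (ys ! 0) (m # tl ys)) then Suc n else 0)"
    by (intro comp_fun_intros 1 2) auto
  then show ?case by simp
qed

text \<open>At most one \<open>n\<close> is a zero preceded only by positive values, so the sum that
  defines bounded search has at most one nonzero term.\<close>

lemma bounded_eval_Mini_eq_Suc_iff:
  "bounded_eval (Mini f) t xs = Suc y \<longleftrightarrow>
    y < t \<and> bounded_eval f t (y # xs) = 1 \<and> (\<forall>m<y. 1 < bounded_eval f t (m # xs))"
proof -
  define P where "P n \<longleftrightarrow> bounded_eval f t (n # xs) = 1 \<and> (\<forall>m<n. 1 < bounded_eval f t (m # xs))" for n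
  have uniq: "n = m" if "P n" "P m" for n m
    using that unfolding P_def by (cases n m rule: linorder_cases) auto
  have eq: "bounded_eval (Mini f) t xs = (\<Sum>n<t. if P n then Suc n else 0)"
    by (simp add: P_def)
  have val: "bounded_eval (Mini f) t xs = Suc n" if "P n" "n < t" for n
  proof -
    have "(\<Sum>m<t. if P m then Suc m else 0) = (\<Sum>m<t. if m = n then Suc n else 0)"
      using uniq that by (intro sum.cong) auto
    then show ?thesis using that eq by simp
  qed
  have "\<exists>n<t. P n" if "bounded_eval (Mini f) t xs = Suc y"
  proof (rule ccontr)
    assume "\<not> (\<exists>n<t. P n)"
    then have "(\<Sum>n<t. if P n then Suc n else 0) = 0" by simp
    then show False using that eq by simp
  qed
  then have "bounded_eval (Mini f) t xs = Suc y \<longleftrightarrow> y < t \<and> P y"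
    using val by (metis Suc_inject)
  then show ?thesis by (simp add: P_def)
qed

lemma bounded_eval_Comp_eq_Suc_iff:
  "bounded_eval (Comp f gs) t xs = Suc z \<longleftrightarrow>
    (\<exists>ys. list_all2 (\<lambda>g y. bounded_eval g t xs = Suc y) gs ys \<and> bounded_eval f t ys = Suc z)"
  (is "?L \<longleftrightarrow> ?R")
proof
  assume L: ?L
  then have nz: "\<And>g. g \<in> set gs \<Longrightarrow> bounded_eval g t xs \<noteq> 0"
    by (auto simp: Let_def split: if_splits)
  have "list_all2 (\<lambda>g y. bounded_eval g t xs = Suc y) gs (map (\<lambda>g. bounded_eval g t xs - 1) gs)"
    using nz by (auto simp: list_all2_conv_all_nth)
  moreover have "bounded_eval f t (map (\<lambda>g. bounded_eval g t xs - 1) gs) = Suc z"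
    using L by (auto simp: Let_def comp_def split: if_splits)
  ultimately show ?R by blast
next
  assume ?R
  then obtain ys where ys: "list_all2 (\<lambda>g y. bounded_eval g t xs = Suc y) gs ys"
    "bounded_eval f t ys = Suc z" by blast
  have "map (\<lambda>g. bounded_eval g t xs) gs = map Suc ys"
    using ys(1) by (induction rule: list_all2_induct) auto
  then have "map (\<lambda>v. v t xs) (map bounded_eval gs) = map Suc ys" by (simp add: comp_def)
  then show ?L using ys(2) by (simp only: bounded_eval.simps Let_def) (simp add: comp_def)
qed

lemma bounded_eval_Prim_Cons:
  "bounded_eval (Prim g h) t (n # xs) =
    rec_nat (bounded_eval g t xs) (\<lambda>m r. if r = 0 then 0 else bounded_eval h t (m # (r - 1) # xs)) n"
  by (simp only: bounded_eval.simps list.sel list.simps if_False)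

lemma bounded_eval_Prim_Suc_eq_Suc_iff:
  "bounded_eval (Prim g h) t (Suc n # xs) = Suc z \<longleftrightarrow>
    (\<exists>r. bounded_eval (Prim g h) t (n # xs) = Suc r \<and> bounded_eval h t (n # r # xs) = Suc z)"
  unfolding bounded_eval_Prim_Cons by (auto simp: gr0_conv_Suc)

text \<open>Fuel only bounds searches, and a successful search keeps its result: by induction the
  zero at \<open>y\<close> and the positive values before it persist, and \<open>y\<close> stays
  below the larger bound.\<close>

lemma bounded_eval_mono:
  "bounded_eval f t xs = Suc y \<Longrightarrow> t \<le> t' \<Longrightarrow> bounded_eval f t' xs = Suc y"
proof (induction f arbitrary: xs y)
  case (Comp f gs)
  from Comp.prems(1) obtain ys where ys: "list_all2 (\<lambda>g y. bounded_eval g t xs = Suc y) gs ys"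
    "bounded_eval f t ys = Suc y"
    unfolding bounded_eval_Comp_eq_Suc_iff by blast
  have "list_all2 (\<lambda>g y. bounded_eval g t' xs = Suc y) gs ys"
    by (rule list.rel_mono_strong[OF ys(1)]) (use Comp in blast)
  then show ?case unfolding bounded_eval_Comp_eq_Suc_iff using Comp.IH(1) Comp.prems(2) ys(2) by blast
next
  case (Prim g h)
  from Prim.prems obtain n xs' where xs: "xs = n # xs'" by (cases xs) auto
  have "bounded_eval (Prim g h) t' (n # xs') = Suc y" if "bounded_eval (Prim g h) t (n # xs') = Suc y"
    using that
  proof (induction n arbitrary: y)
    case 0
    then show ?case using Prim.IH(1) Prim.prems(2) by auto
  next
    case (Suc n)
    then show ?case
      using Prim.IH(2) Prim.prems(2) unfolding bounded_eval_Prim_Suc_eq_Suc_iff by blast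
  qed
  then show ?case using xs Prim.prems by blast
next
  case (Mini f)
  have "1 < bounded_eval f t' (m # xs)" if m: "1 < bounded_eval f t (m # xs)" for m
    using Mini.IH[of "m # xs" "bounded_eval f t (m # xs) - 1"] Mini.prems(2) m by simp
  then show ?case
    using Mini.IH[of "y # xs" 0] Mini.prems unfolding bounded_eval_Mini_eq_Suc_iff by auto
qed auto

lemma bounded_eval_sound: "bounded_eval f t xs = Suc y \<Longrightarrow> eval f xs y"
proof (induction f arbitrary: xs y)
  case Zero
  then show ?case by (simp add: eval_Zero)
next
  case Succ
  then show ?case by (cases xs) (auto intro: eval_Succ)
next
  case (Proj i)
  then show ?case by (auto intro: eval_Proj split: if_splits)
next
  case (Comp f gs)
  then obtain ys where ys: "list_all2 (\<lambda>g y. bounded_eval g t xs = Suc y) gs ys" "bounded_eval f t ys = Suc y"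
    unfolding bounded_eval_Comp_eq_Suc_iff by blast
  have "list_all2 (\<lambda>g y. eval g xs y) gs ys"
    by (rule list.rel_mono_strong[OF ys(1)]) (use Comp in blast)
  then show ?case using Comp.IH(1)[OF ys(2)] by (rule eval_Comp)
next
  case (Prim g h)
  from Prim.prems obtain n xs' where xs: "xs = n # xs'" by (cases xs) auto
  have "eval (Prim g h) (n # xs') y" if "bounded_eval (Prim g h) t (n # xs') = Suc y"
    using that
  proof (induction n arbitrary: y)
    case 0
    then show ?case using Prim.IH(1) by (auto intro: eval_Prim0)
  next
    case (Suc n)
    then show ?case
      using Prim.IH(2) unfolding bounded_eval_Prim_Suc_eq_Suc_iff by (blast intro: eval_PrimS)
  qed
  then show ?case using xs Prim.prems by blast
next
  case (Mini f)
  have "\<exists>z. eval f (m # xs) (Suc z)" if m: "1 < bounded_eval f t (m # xs)" for m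
    using Mini.IH[of "m # xs"] less_imp_Suc_add[OF m] by auto
  then show ?case
    using Mini.IH[of "y # xs" 0] Mini.prems unfolding bounded_eval_Mini_eq_Suc_iff
    by (auto intro!: eval_Mini)
qed

text \<open>Each rule of \<open>eval\<close> has finitely many premises for given arguments, and by
  monotonicity one sufficiently large fuel serves all of them.\<close>

lemma bounded_eval_complete: "eval f xs y \<Longrightarrow> \<exists>t. bounded_eval f t xs = Suc y"
proof (induction rule: eval.induct)
  case (eval_Comp xs gs ys f z)
  have "\<exists>t. list_all2 (\<lambda>g y. bounded_eval g t xs = Suc y) gs ys"
    using eval_Comp(1)
  proof (induction rule: list_all2_induct)
    case (Cons g gs y ys)
    then obtain t1 t2 where t: "bounded_eval g t1 xs = Suc y"
      "list_all2 (\<lambda>g y. bounded_eval g t2 xs = Suc y) gs ys" by blast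
    have "list_all2 (\<lambda>g y. bounded_eval g (max t1 t2) xs = Suc y) gs ys"
      using t(2) by (rule list_all2_mono) (erule bounded_eval_mono, simp)
    moreover have "bounded_eval g (max t1 t2) xs = Suc y" using t(1) by (rule bounded_eval_mono) simp
    ultimately show ?case by auto
  qed auto
  then obtain t1 where t1: "list_all2 (\<lambda>g y. bounded_eval g t1 xs = Suc y) gs ys" by blast
  from eval_Comp obtain t2 where t2: "bounded_eval f t2 ys = Suc z" by blast
  have "list_all2 (\<lambda>g y. bounded_eval g (max t1 t2) xs = Suc y) gs ys"
    using t1 by (rule list_all2_mono) (erule bounded_eval_mono, simp)
  moreover have "bounded_eval f (max t1 t2) ys = Suc z" using t2 by (rule bounded_eval_mono) simp
  ultimately show ?case unfolding bounded_eval_Comp_eq_Suc_iff by blast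
next
  case (eval_PrimS g h n xs y z)
  then obtain t1 t2 where t: "bounded_eval (Prim g h) t1 (n # xs) = Suc y"
    "bounded_eval h t2 (n # y # xs) = Suc z" by blast
  have "bounded_eval (Prim g h) (max t1 t2) (n # xs) = Suc y"
    "bounded_eval h (max t1 t2) (n # y # xs) = Suc z"
    using bounded_eval_mono[OF t(1)] bounded_eval_mono[OF t(2)] by (meson max.cobounded1 max.cobounded2)+
  then show ?case unfolding bounded_eval_Prim_Suc_eq_Suc_iff by blast
next
  case (eval_Mini f n xs)
  from eval_Mini obtain t0 where t0: "bounded_eval f t0 (n # xs) = 1" by auto
  have "\<exists>t. \<forall>m<k. 1 < bounded_eval f t (m # xs)" if "k \<le> n" for k
    using that
  proof (induction k)
    case (Suc k)
    then obtain t1 where t1: "\<forall>m<k. 1 < bounded_eval f t1 (m # xs)" by auto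
    from Suc eval_Mini obtain t2 z where t2: "bounded_eval f t2 (k # xs) = Suc (Suc z)"
      by (meson Suc_le_eq)
    have "1 < bounded_eval f (max t1 t2) (m # xs)" if "m < Suc k" for m
    proof (cases "m = k")
      case True
      then show ?thesis using bounded_eval_mono[OF t2, of "max t1 t2"] by simp
    next
      case False
      then have "1 < bounded_eval f t1 (m # xs)" using t1 that by simp
      then show ?thesis
        using bounded_eval_mono[of f t1 "m # xs" "bounded_eval f t1 (m # xs) - 1" "max t1 t2"] by simp
    qed
    then show ?case by blast
  qed simp
  then obtain t1 where t1: "\<forall>m<n. 1 < bounded_eval f t1 (m # xs)" by blast
  \<comment> \<open>The summand \<open>Suc n\<close> puts \<open>n\<close> itself within the range
    of the bounded search.\<close>
  define t where "t = Suc n + t0 + t1"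
  have "bounded_eval f t (n # xs) = 1"
    using bounded_eval_mono[of f t0 "n # xs" 0 t] t0 by (simp add: t_def)
  moreover have "1 < bounded_eval f t (m # xs)" if "m < n" for m
    using bounded_eval_mono[of f t1 "m # xs" "bounded_eval f t1 (m # xs) - 1" t] t1 that
    by (force simp: t_def)
  ultimately have "bounded_eval (Mini f) t xs = Suc n"
    unfolding bounded_eval_Mini_eq_Suc_iff by (simp add: t_def)
  then show ?case by blast
qed auto

lemma eval_iff_bounded_eval: "eval f xs y \<longleftrightarrow> (\<exists>t. bounded_eval f t xs = Suc y)"
  using bounded_eval_sound bounded_eval_complete by blast

text \<open>Both values are results of the function \<open>bounded_eval\<close> at a common fuel,
  which yields determinism without another induction.\<close>

lemma eval_functional:
  assumes "eval f xs y" "eval f xs z"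
  shows "y = z"
proof -
  obtain t1 t2 where "bounded_eval f t1 xs = Suc y" "bounded_eval f t2 xs = Suc z"
    using assms eval_iff_bounded_eval by blast
  then have "Suc y = Suc z"
    by (metis bounded_eval_mono max.cobounded1 max.cobounded2)
  then show ?thesis by simp
qed

subsection \<open>Codes of binary strings\<close>

text \<open>The point is the number of binary digits of the successor, exactly
  \<open>length s + 1\<close>, from which arithmetic recovers the length.\<close>

lemma Suc_str_to_nat_bounds:
  "2 ^ length s \<le> Suc (str_to_nat s)" "Suc (str_to_nat s) < 2 ^ Suc (length s)"
  by (induction s) auto

lemma str_to_nat_digit:
  "i < length s \<Longrightarrow> Suc (str_to_nat s) div 2 ^ i mod 2 = of_bool (s ! i)"
proof (induction s arbitrary: i)
  case (Cons b s)
  have step: "Suc (str_to_nat (b # s)) = 2 * Suc (str_to_nat s) + of_bool b" by simp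
  show ?case
  proof (cases i)
    case 0
    then show ?thesis unfolding step by simp
  next
    case (Suc j)
    have "Suc (str_to_nat (b # s)) div 2 ^ i = Suc (str_to_nat (b # s)) div 2 div 2 ^ j"
      by (simp only: Suc power_Suc div_mult2_eq)
    also have "Suc (str_to_nat (b # s)) div 2 = Suc (str_to_nat s)"
      unfolding step by simp
    finally show ?thesis using Cons Suc by simp
  qed
qed simp

text \<open>In binary, \<open>Suc (str_to_nat s)\<close> is a leading \<open>1\<close> followed by the reversal of \<open>s\<close>, whereas
  \<open>code_value\<close> reads \<open>s\<close> with its first bit as the most significant one, as in \<open>bits\<close>.\<close>
definition code_length :: "nat \<Rightarrow> nat" where
  "code_length m = (\<Sum>i<m. of_bool (2 ^ Suc i \<le> Suc m))"

definition code_value :: "nat \<Rightarrow> nat" where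
  "code_value m = (\<Sum>i<code_length m. (Suc m div 2 ^ i mod 2) * 2 ^ (code_length m - Suc i))"

lemma code_length_str_to_nat [simp]: "code_length (str_to_nat s) = length s"
proof -
  let ?m = "str_to_nat s"
  have le: "length s \<le> ?m" by (induction s) auto
  have iff: "2 ^ Suc i \<le> Suc ?m \<longleftrightarrow> i < length s" for i
  proof
    assume "2 ^ Suc i \<le> Suc ?m"
    with Suc_str_to_nat_bounds(2)[of s] have "(2::nat) ^ Suc i < 2 ^ Suc (length s)" by linarith
    then show "i < length s" by (simp del: power_Suc)
  next
    assume "i < length s"
    then have "(2::nat) ^ Suc i \<le> 2 ^ length s" by (intro power_increasing) auto
    then show "2 ^ Suc i \<le> Suc ?m" using Suc_str_to_nat_bounds(1)[of s] by linarith
  qed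
  have "{..<?m} \<inter> {i. i < length s} = {..<length s}" using le by auto
  then show ?thesis unfolding code_length_def iff by simp
qed

lemma code_value_str_to_nat:
  "code_value (str_to_nat s) = (\<Sum>i<length s. of_bool (s ! i) * 2 ^ (length s - Suc i))"
  by (simp add: code_value_def str_to_nat_digit)

lemma inj_str_to_nat: "str_to_nat s = str_to_nat t \<Longrightarrow> s = t"
proof (rule nth_equalityI)
  assume eq: "str_to_nat s = str_to_nat t"
  then show len: "length s = length t" by (metis code_length_str_to_nat)
  fix i assume "i < length s"
  then show "s ! i = t ! i"
    using str_to_nat_digit[of i s] str_to_nat_digit[of i t] eq len by (simp add: of_bool_eq_iff)
qed

text \<open>Every positive number is \<open>2 * k + 1\<close> or \<open>2 * k + 2\<close> for a
  smaller \<open>k\<close>, which fixes the first bit. Thus every number that a program returns is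
  the code of a string.\<close>

lemma surj_str_to_nat: "\<exists>s. str_to_nat s = m"
proof (induction m rule: less_induct)
  case (less m)
  have "m = 0 \<or> (\<exists>k. m = 2 * k + 1) \<or> (\<exists>k. m = 2 * k + 2)" by presburger
  then consider "m = 0" | k where "m = 2 * k + 1" | k where "m = 2 * k + 2" by blast
  then show ?case
  proof cases
    case 1
    then show ?thesis using str_to_nat.simps(1) by blast
  next
    case (2 k)
    then obtain s where "str_to_nat s = k" using less[of k] by auto
    then have "str_to_nat (False # s) = m" using 2 by simp
    then show ?thesis by blast
  next
    case (3 k)
    then obtain s where "str_to_nat s = k" using less[of k] by auto
    then have "str_to_nat (True # s) = m" using 3 by simp
    then show ?thesis by blast
  qed
qed

lemma comp_fun_code_length: "comp_fun n F \<Longrightarrow> comp_fun n (\<lambda>xs. code_length (F xs))"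
  by (erule comp_fun_compose1[rotated], unfold code_length_def, intro comp_fun_intros) auto

lemma comp_fun_code_value: "comp_fun n F \<Longrightarrow> comp_fun n (\<lambda>xs. code_value (F xs))"
  by (erule comp_fun_compose1[rotated], unfold code_value_def,
      intro comp_fun_intros comp_fun_code_length) auto

lemma comp_fun_bounded_eval1:
  assumes "comp_fun n T" "comp_fun n P"
  shows "comp_fun n (\<lambda>xs. bounded_eval f (T xs) [P xs])"
proof (rule comp_fun_compose2[OF _ assms])
  show "comp_fun 2 (\<lambda>xs. bounded_eval f (xs ! 0) [xs ! 1])"
    using comp_fun_bounded_eval[of 1 f] unfolding Suc_1
    by (rule comp_fun_cong) (auto simp: length_Suc_conv numeral_2_eq_2)
qed

subsection \<open>Stages of the enumeration of compressible strings\<close>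

text \<open>A single parameter \<open>t\<close> bounds both the fuel and the codes of the programs
  tried, so that the stages dovetail all computations and remain decidable.\<close>

definition enumerated :: "recf \<Rightarrow> nat \<Rightarrow> nat \<Rightarrow> bool" where
  "enumerated f t m \<longleftrightarrow> (\<exists>p<t. bounded_eval f t [p] = Suc m \<and> code_length p < code_length m)"

text \<open>The weight found by stage \<open>t\<close>, scaled by \<open>2 ^ t\<close> to a natural
  number. Codes below \<open>t\<close> belong to strings of length at most \<open>t\<close>, so the
  subtraction is exact.\<close>

definition stage_mass :: "recf \<Rightarrow> nat \<Rightarrow> nat" where
  "stage_mass f t = (\<Sum>m<t. of_bool (enumerated f t m) * 2 ^ (t - code_length m))"

lemma comp_pred_enumerated:
  assumes "comp_fun n T" "comp_fun n M"
  shows "comp_pred n (\<lambda>xs. enumerated f (T xs) (M xs))"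
proof -
  have "comp_fun 2 (\<lambda>xs. of_bool (enumerated f (xs ! 0) (xs ! 1)))"
    unfolding enumerated_def
    by (intro comp_fun_intros comp_fun_bounded_eval1 comp_fun_code_length) auto
  then show ?thesis
    unfolding comp_pred_def
    using comp_fun_compose2[of "\<lambda>t m. of_bool (enumerated f t m)", OF _ assms] by simp
qed

lemma comp_fun_stage_mass: "comp_fun n T \<Longrightarrow> comp_fun n (\<lambda>xs. stage_mass f (T xs))"
  by (erule comp_fun_compose1[rotated], unfold stage_mass_def,
      intro comp_fun_intros comp_pred_enumerated comp_fun_code_length) auto

lemma total_recursive_if_comp_fun:
  assumes "comp_fun 1 (\<lambda>xs. g (xs ! 0))"
  shows "total_recursive g"
proof -
  obtain f where f: "\<And>xs. length xs = 1 \<Longrightarrow> eval f xs (g (xs ! 0))"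
    using assms unfolding comp_fun_def by blast
  have "eval f [x] (g x)" for x using f[of "[x]"] by simp
  then have "\<forall>x y. Some (g x) = Some y \<longleftrightarrow> eval f [x] y"
    using eval_functional by blast
  then show ?thesis unfolding total_recursive_def partial_recursive_def by blast
qed

subsection \<open>Kraft's inequality and binary expansions\<close>

lemma card_prefix_extensions:
  assumes "length p \<le> L"
  shows "card {x :: bool list. length x = L \<and> prefix p x} = 2 ^ (L - length p)"
proof -
  have "{x. length x = L \<and> prefix p x} = (@) p ` {y. length y = L - length p}"
    using assms by (auto simp: prefix_def)
  then have "card {x. length x = L \<and> prefix p x} = card {y :: bool list. length y = L - length p}"
    by (simp add: card_image inj_on_def)
  also have "\<dots> = 2 ^ (L - length p)"
    using card_lists_length_eq[of "UNIV :: bool set" "L - length p"] by simp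
  finally show ?thesis .
qed

text \<open>Every \<open>p\<close> is replaced by its extensions of a common length
  \<open>L\<close>. Prefix-freeness makes these sets disjoint, and together they contain at most
  \<open>2 ^ L\<close> strings.\<close>

lemma Kraft_inequality_finite:
  fixes P :: "bool list set"
  assumes fin: "finite P" and pf: "\<And>p q. p \<in> P \<Longrightarrow> q \<in> P \<Longrightarrow> prefix p q \<Longrightarrow> p = q"
  shows "(\<Sum>p\<in>P. (1/2::real) ^ length p) \<le> 1"
proof -
  define L where "L = Max (insert 0 (length ` P))"
  have L: "length p \<le> L" if "p \<in> P" for p
    using that fin unfolding L_def by (intro Max_ge) auto
  define E where "E p = {x. length x = L \<and> prefix p x}" for p :: "bool list"
  have finL: "finite {x :: bool list. length x = L}"
    using finite_lists_length_eq[of "UNIV :: bool set" L] by simp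
  have "(\<Sum>p\<in>P. 2 ^ (L - length p)) = (\<Sum>p\<in>P. card (E p))"
    using card_prefix_extensions L unfolding E_def by simp
  also have "\<dots> = card (\<Union>p\<in>P. E p)"
  proof (rule card_UN_disjoint[symmetric])
    show "\<forall>p\<in>P. finite (E p)"
      using finL by (auto simp: E_def intro: finite_subset[rotated])
    show "\<forall>p\<in>P. \<forall>q\<in>P. p \<noteq> q \<longrightarrow> E p \<inter> E q = {}"
      using pf prefix_same_cases unfolding E_def by blast
  qed (fact fin)
  also have "\<dots> \<le> card {x :: bool list. length x = L}"
    by (rule card_mono[OF finL]) (auto simp: E_def)
  also have "\<dots> = 2 ^ L"
    using card_lists_length_eq[of "UNIV :: bool set" L] by simp
  finally have "(\<Sum>p\<in>P. 2 ^ (L - length p)) \<le> (2::nat) ^ L" .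
  then have "real (\<Sum>p\<in>P. 2 ^ (L - length p)) \<le> real (2 ^ L)" unfolding of_nat_le_iff .
  then have "(\<Sum>p\<in>P. (2::real) ^ (L - length p)) \<le> 2 ^ L" by simp
  moreover have "(\<Sum>p\<in>P. (2::real) ^ (L - length p)) = 2 ^ L * (\<Sum>p\<in>P. (1/2) ^ length p)"
    unfolding sum_distrib_left
    by (intro sum.cong refl) (use L in \<open>simp add: power_diff power_divide\<close>)
  ultimately show ?thesis by simp
qed

lemma Hc_less_iff: "Hc C s < enat n \<longleftrightarrow> (\<exists>p. C p = Some s \<and> length p < n)"
  unfolding Hc_def by (simp add: INF_less_iff)

text \<open>Doubling \<open>y\<close> appends one binary digit: the floor of \<open>2 * y\<close> is
  twice the floor of \<open>y\<close>, possibly plus one, and its parity tells which.\<close>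

lemma bits_value:
  "int (\<Sum>i<n. of_bool (bits \<alpha> n ! i) * 2 ^ (n - Suc i)) = \<lfloor>2 ^ n * frac \<alpha>\<rfloor>"
proof -
  have "int (\<Sum>i<n. of_bool (odd \<lfloor>2 ^ Suc i * frac \<alpha>\<rfloor>) * 2 ^ (n - Suc i)) = \<lfloor>2 ^ n * frac \<alpha>\<rfloor>"
  proof (induction n)
    case 0
    show ?case by (simp add: frac_lt_1 floor_eq_iff)
  next
    case (Suc n)
    let ?b = "\<lambda>i. of_bool (odd \<lfloor>2 ^ Suc i * frac \<alpha>\<rfloor>) :: nat"
    let ?y = "2 ^ n * frac \<alpha>"
    have "(\<Sum>i<n. ?b i * 2 ^ (Suc n - Suc i)) = 2 * (\<Sum>i<n. ?b i * 2 ^ (n - Suc i))"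
      unfolding sum_distrib_left
      by (intro sum.cong refl) (simp add: Suc_diff_Suc[symmetric] del: diff_Suc_Suc)
    then have "int (\<Sum>i<Suc n. ?b i * 2 ^ (Suc n - Suc i)) = 2 * \<lfloor>?y\<rfloor> + of_bool (odd \<lfloor>2 * ?y\<rfloor>)"
      using Suc by (simp add: mult.assoc)
    also have "\<dots> = \<lfloor>2 * ?y\<rfloor>"
    proof -
      have "\<lfloor>2 * ?y\<rfloor> = 2 * \<lfloor>?y\<rfloor> \<or> \<lfloor>2 * ?y\<rfloor> = 2 * \<lfloor>?y\<rfloor> + 1" by linarith
      then show ?thesis by auto
    qed
    finally show ?case by (simp add: mult.assoc)
  qed
  then show ?thesis by (simp add: bits_def)
qed

section \<open>Unbounded search and machines given by programs\<close>

lemma ex_eval_Least: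
  assumes "comp_pred (Suc n) (\<lambda>ys. P (ys ! 0) (tl ys))"
  shows "\<exists>g. \<forall>xs k. length xs = n \<longrightarrow> P k xs \<longrightarrow> eval g xs (LEAST k. P k xs)"
proof -
  \<comment> \<open>\<open>Mini\<close> looks for a zero, hence the characteristic function of the
    negation.\<close>
  have "comp_fun (Suc n) (\<lambda>ys. of_bool (\<not> P (ys ! 0) (tl ys)))"
    using comp_pred_not[OF assms] by (simp add: comp_pred_def)
  then obtain h where h: "\<And>ys. length ys = Suc n \<Longrightarrow> eval h ys (of_bool (\<not> P (ys ! 0) (tl ys)))"
    unfolding comp_fun_def by blast
  have "eval (Mini h) xs (LEAST k. P k xs)" if "length xs = n" "P k xs" for xs k
  proof (rule eval_Mini)
    show "eval h ((LEAST k. P k xs) # xs) 0"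
      using h[of "(LEAST k. P k xs) # xs"] that LeastI[of "\<lambda>k. P k xs" k] by simp
    show "\<forall>m<LEAST k. P k xs. \<exists>y. eval h (m # xs) (Suc y)"
    proof (intro allI impI exI)
      fix m assume "m < (LEAST k. P k xs)"
      then have "\<not> P m xs" by (rule not_less_Least)
      then show "eval h (m # xs) (Suc 0)" using h[of "m # xs"] that by simp
    qed
  qed
  then show ?thesis by blast
qed

text \<open>Determinism of \<open>eval\<close> and injectivity of the coding leave at most one
  candidate output, so a choice defines the machine unambiguously.\<close>

lemma ex_machine_of_recf:
  "\<exists>C. \<forall>p s. C p = Some s \<longleftrightarrow> eval f [str_to_nat p] (str_to_nat s)"
proof -
  define C where "C p = (if \<exists>s. eval f [str_to_nat p] (str_to_nat s)
    then Some (SOME s. eval f [str_to_nat p] (str_to_nat s)) else None)" for p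
  have "C p = Some s \<longleftrightarrow> eval f [str_to_nat p] (str_to_nat s)" for p s
  proof
    assume "C p = Some s"
    then show "eval f [str_to_nat p] (str_to_nat s)"
      unfolding C_def by (metis (mono_tags, lifting) option.distinct(1) option.inject someI_ex)
  next
    assume s: "eval f [str_to_nat p] (str_to_nat s)"
    then have "eval f [str_to_nat p] (str_to_nat (SOME s. eval f [str_to_nat p] (str_to_nat s)))"
      by (rule someI)
    then have "(SOME s. eval f [str_to_nat p] (str_to_nat s)) = s"
      using s eval_functional inj_str_to_nat by blast
    then show "C p = Some s" using s unfolding C_def by auto
  qed
  then show ?thesis by blast
qed

subsection \<open>Compressible strings of a prefix-free machine\<close>

text \<open>Stages depend on the program \<open>f\<close> and not only on the function
  \<open>V\<close>, so one program is fixed together with the machine.\<close>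

locale prefix_free_program =
  fixes V :: "bool list \<Rightarrow> bool list option" and f :: recf
  assumes program: "V p = Some s \<longleftrightarrow> eval f [str_to_nat p] (str_to_nat s)"
    and prefix_free: "p \<in> dom V \<Longrightarrow> q \<in> dom V \<Longrightarrow> prefix p q \<Longrightarrow> p = q"
begin

definition compressible :: "bool list set" where
  "compressible = {s. Hc V s < enat (length s)}"

definition stage :: "nat \<Rightarrow> bool list set" where
  "stage t = {s. str_to_nat s < t \<and> enumerated f t (str_to_nat s)}"

lemma compressible_iff: "s \<in> compressible \<longleftrightarrow> (\<exists>p. V p = Some s \<and> length p < length s)"
  by (simp add: compressible_def Hc_less_iff)

lemma enumerated_imp_compressible:
  assumes "enumerated f t (str_to_nat s)"
  shows "s \<in> compressible"
proof -
  obtain m where m: "bounded_eval f t [m] = Suc (str_to_nat s)" "code_length m < length s"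
    using assms unfolding enumerated_def by auto
  obtain p where "m = str_to_nat p" using surj_str_to_nat by metis
  then show ?thesis
    using m bounded_eval_sound[OF m(1)] by (auto simp: compressible_iff program)
qed

lemma stage_subset_compressible: "stage t \<subseteq> compressible"
  using enumerated_imp_compressible by (auto simp: stage_def)

lemma eventually_mem_stage:
  assumes "s \<in> compressible"
  shows "\<forall>\<^sub>F t in sequentially. s \<in> stage t"
proof -
  obtain p where p: "V p = Some s" "length p < length s"
    using assms compressible_iff by blast
  obtain t0 where t0: "bounded_eval f t0 [str_to_nat p] = Suc (str_to_nat s)"
    using p(1) program bounded_eval_complete by blast
  have "s \<in> stage t" if "t \<ge> Suc (t0 + str_to_nat p + str_to_nat s)" for t
    using that p(2) bounded_eval_mono[OF t0, of t]
    by (auto simp: stage_def enumerated_def intro!: exI[of _ "str_to_nat p"])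
  then show ?thesis unfolding eventually_sequentially by blast
qed

lemma bij_betw_codes_less: "bij_betw str_to_nat {s. str_to_nat s < t} {..<t}"
proof (rule bij_betw_imageI)
  show "inj_on str_to_nat {s. str_to_nat s < t}"
    using inj_str_to_nat by (auto simp: inj_on_def)
  have "m \<in> str_to_nat ` {s. str_to_nat s < t}" if "m < t" for m
    using surj_str_to_nat[of m] that by auto
  then show "str_to_nat ` {s. str_to_nat s < t} = {..<t}" by auto
qed

lemma finite_stage: "finite (stage t)"
proof -
  have "finite {s. str_to_nat s < t}"
    using bij_betw_finite[OF bij_betw_codes_less] by simp
  then show ?thesis by (rule rev_finite_subset) (auto simp: stage_def)
qed

lemma sum_stage: "(\<Sum>s\<in>stage t. (1/2::real) ^ length s) = real (stage_mass f t) / 2 ^ t"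
proof -
  let ?S = "{s. str_to_nat s < t}"
  have fin: "finite ?S" using bij_betw_finite[OF bij_betw_codes_less] by simp
  have len: "length s \<le> str_to_nat s" for s by (induction s) auto
  have "real (stage_mass f t) / 2 ^ t =
      (\<Sum>m<t. of_bool (enumerated f t m) * 2 ^ (t - code_length m) / 2 ^ t)"
    by (simp add: stage_mass_def sum_divide_distrib del: sum_of_bool_mult_eq)
  also have "\<dots> = (\<Sum>s\<in>?S. of_bool (enumerated f t (str_to_nat s)) * 2 ^ (t - length s) / 2 ^ t)"
    using sum.reindex_bij_betw[OF bij_betw_codes_less, symmetric,
        of "\<lambda>m. of_bool (enumerated f t m) * 2 ^ (t - code_length m) / 2 ^ t" t]
    by (simp del: sum_of_bool_mult_eq)
  also have "\<dots> = (\<Sum>s\<in>?S. if s \<in> stage t then (1/2) ^ length s else 0)"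
  proof (rule sum.cong[OF refl])
    fix s assume s: "s \<in> ?S"
    then have "length s \<le> t" using len[of s] by simp
    then have "(2::real) ^ (t - length s) / 2 ^ t = (1/2) ^ length s"
      by (simp add: power_diff power_divide)
    then show "of_bool (enumerated f t (str_to_nat s)) * 2 ^ (t - length s) / 2 ^ t =
      (if s \<in> stage t then (1/2) ^ length s else (0::real))"
      using s by (simp add: stage_def)
  qed
  also have "\<dots> = (\<Sum>s\<in>stage t. (1/2) ^ length s)"
  proof -
    have "?S \<inter> stage t = stage t" by (auto simp: stage_def)
    then show ?thesis using sum.inter_restrict[OF fin, of "\<lambda>s. (1/2::real) ^ length s" "stage t"] by simp
  qed
  finally show ?thesis by simp
qed

text \<open>A compressible string has a program shorter by at least one bit, which gains a factor 2
  over Kraft's inequality.\<close>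
lemma sum_compressible_le_half:
  assumes "finite F" "F \<subseteq> compressible"
  shows "(\<Sum>s\<in>F. (1/2::real) ^ length s) \<le> 1/2"
proof -
  obtain p where p: "\<And>s. s \<in> F \<Longrightarrow> V (p s) = Some s \<and> length (p s) < length s"
    using assms(2) unfolding subset_iff compressible_iff by metis
  have inj: "inj_on p F"
    using p by (metis inj_onI option.inject)
  have "2 * (\<Sum>s\<in>F. (1/2::real) ^ length s) \<le> (\<Sum>s\<in>F. (1/2) ^ length (p s))"
    unfolding sum_distrib_left
  proof (rule sum_mono)
    fix s assume "s \<in> F"
    then have "Suc (length (p s)) \<le> length s" using p by (simp add: Suc_le_eq)
    then have "(1/2::real) ^ length s \<le> (1/2) ^ Suc (length (p s))"
      by (intro power_decreasing) auto
    then show "2 * (1/2::real) ^ length s \<le> (1/2) ^ length (p s)" by simp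
  qed
  also have "\<dots> = (\<Sum>q\<in>p ` F. (1/2) ^ length q)"
    by (simp add: sum.reindex[OF inj])
  also have "\<dots> \<le> 1"
    by (rule Kraft_inequality_finite) (use assms(1) p in \<open>auto intro!: prefix_free\<close>)
  finally show ?thesis by simp
qed

section \<open>\<open>Theta V\<close> as the limit of stage masses\<close>

lemma weight_summable: "(\<lambda>s. (1/2::real) ^ length s) summable_on compressible"
  by (rule nonneg_bdd_above_summable_on)
    (use sum_compressible_le_half in \<open>auto intro!: bdd_aboveI[of _ "1/2"]\<close>)

lemma Theta_eq: "Theta V = infsum (\<lambda>s. (1/2::real) ^ length s) compressible"
  by (simp add: Theta_def compressible_def)

lemma sum_le_Theta:
  assumes "finite F" "F \<subseteq> compressible"
  shows "(\<Sum>s\<in>F. (1/2::real) ^ length s) \<le> Theta V"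
  unfolding Theta_eq using assms by (intro finite_sum_le_infsum weight_summable) auto

text \<open>The bound \<open>1/2\<close> on finite sums leaves room below \<open>1\<close>, so
  \<open>Theta V\<close> is its own fractional part, which is what \<open>bits\<close>
  reads.\<close>

lemma Theta_bounds: "0 \<le> Theta V" "Theta V < 1"
proof -
  show "0 \<le> Theta V" using sum_le_Theta[of "{}"] by simp
  have "Theta V \<le> 1/2" unfolding Theta_eq
    by (rule infsum_le_finite_sums[OF weight_summable]) (rule sum_compressible_le_half)
  then show "Theta V < 1" by simp
qed

lemma stage_mass_le_Theta: "real (stage_mass f t) / 2 ^ t \<le> Theta V"
  using sum_le_Theta[OF finite_stage stage_subset_compressible] by (simp add: sum_stage)

text \<open>Finite subsums come arbitrarily close to \<open>Theta V\<close>, and every finite set of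
  compressible strings lies in all late stages; no stage exceeds the limit.\<close>

lemma stage_mass_tendsto_Theta: "(\<lambda>t. real (stage_mass f t) / 2 ^ t) \<longlonglongrightarrow> Theta V"
proof (rule order_tendstoI)
  fix a assume "a < Theta V"
  have "((\<lambda>s. (1/2::real) ^ length s) has_sum Theta V) compressible"
    unfolding Theta_eq using weight_summable by (rule has_sum_infsum)
  then have "(sum (\<lambda>s. (1/2::real) ^ length s) \<longlongrightarrow> Theta V) (finite_subsets_at_top compressible)"
    by (simp add: has_sum_def)
  from order_tendstoD(1)[OF this \<open>a < Theta V\<close>]
  obtain F where F: "finite F" "F \<subseteq> compressible" "a < (\<Sum>s\<in>F. (1/2::real) ^ length s)"
    unfolding eventually_finite_subsets_at_top by auto
  have "\<forall>\<^sub>F t in sequentially. \<forall>s\<in>F. s \<in> stage t"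
    using F eventually_mem_stage by (intro eventually_ball_finite) auto
  then show "\<forall>\<^sub>F t in sequentially. a < real (stage_mass f t) / 2 ^ t"
  proof eventually_elim
    case (elim t)
    have "(\<Sum>s\<in>F. (1/2::real) ^ length s) \<le> (\<Sum>s\<in>stage t. (1/2) ^ length s)"
      using elim by (intro sum_mono2 finite_stage) auto
    then show ?case using F(3) by (simp add: sum_stage)
  qed
next
  fix a assume "Theta V < a"
  then show "\<forall>\<^sub>F t in sequentially. real (stage_mass f t) / 2 ^ t < a"
    using stage_mass_le_Theta by (intro always_eventually allI) (rule le_less_trans)
qed

lemma left_computable_Theta: "left_computable (Theta V)"
proof -
  define F :: "nat \<Rightarrow> rat" where "F n = - of_nat (stage_mass f n) / 2 ^ n" for n
  have F: "real_of_rat (F n) = - (real (stage_mass f n) / 2 ^ n)" for n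
    by (simp add: F_def of_rat_divide of_rat_minus of_rat_power)
  have "computable_rat_seq F"
    unfolding computable_rat_seq_def
  proof (intro exI conjI allI)
    show "total_recursive (\<lambda>n. 0)"
      by (intro total_recursive_if_comp_fun comp_fun_const)
    show "total_recursive (stage_mass f)"
      by (intro total_recursive_if_comp_fun comp_fun_stage_mass comp_fun_nth) simp
    \<comment> \<open>\<open>computable_rat_seq\<close> divides by \<open>c n + 1\<close>, so the
      denominator \<open>2 ^ n\<close> is given as \<open>2 ^ n - 1\<close>.\<close>
    show "total_recursive (\<lambda>n. 2 ^ n - 1)"
      by (intro total_recursive_if_comp_fun comp_fun_intros) simp
    have "of_nat (2 ^ n - 1 + 1) = (2 ^ n :: rat)" for n :: nat
      by (subst le_add_diff_inverse2) auto
    then show "F n = (of_nat 0 - of_nat (stage_mass f n)) / of_nat (2 ^ n - 1 + 1)" for n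
      by (simp only: F_def) simp
  qed
  moreover have "(\<lambda>n. real_of_rat (F n)) \<longlonglongrightarrow> - Theta V"
    unfolding F by (intro tendsto_minus stage_mass_tendsto_Theta)
  ultimately show ?thesis
    unfolding left_computable_def right_computable_def using F stage_mass_le_Theta by fastforce
qed

section \<open>Incompressible strings from the bits of \<open>Theta V\<close>\<close>

lemma ex_incompressible: "\<exists>s. length s = k \<and> s \<notin> compressible"
proof (rule ccontr)
  assume "\<not> ?thesis"
  then have "{s. length s = k} \<subseteq> compressible" by blast
  moreover have "finite {s :: bool list. length s = k}"
    using finite_lists_length_eq[of "UNIV :: bool set" k] by simp
  ultimately have "(\<Sum>s | length (s :: bool list) = k. (1/2::real) ^ length s) \<le> 1/2"
    by (rule sum_compressible_le_half[rotated])
  \<comment> \<open>All \<open>2 ^ k\<close> strings of length \<open>k\<close> have total weight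
    \<open>1\<close>, twice what compressible strings may have.\<close>
  moreover have "card {s :: bool list. length s = k} = 2 ^ k"
    using card_lists_length_eq[of "UNIV :: bool set" k] by simp
  ultimately show False by (simp add: power_divide)
qed

text \<open>A missed string of length at most \<open>k\<close> would raise the weight of the stage
  by at least \<open>(1/2) ^ k\<close>, beyond the total \<open>Theta V\<close>.\<close>

lemma compressible_imp_enumerated:
  assumes "Theta V < real (stage_mass f t) / 2 ^ t + (1/2) ^ k" "s \<in> compressible" "length s \<le> k"
  shows "enumerated f t (str_to_nat s)"
proof (rule ccontr)
  assume "\<not> enumerated f t (str_to_nat s)"
  then have s: "s \<notin> stage t" by (simp add: stage_def)
  have "(\<Sum>s\<in>insert s (stage t). (1/2::real) ^ length s) \<le> Theta V"
    using assms(2) stage_subset_compressible finite_stage by (intro sum_le_Theta) auto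
  then have "(1/2) ^ length s + real (stage_mass f t) / 2 ^ t \<le> Theta V"
    using s finite_stage by (simp add: sum_stage)
  moreover have "(1/2::real) ^ k \<le> (1/2) ^ length s"
    using assms(3) by (intro power_decreasing) auto
  ultimately show False using assms(1) by linarith
qed

text \<open>The slack of one unit in the last place guarantees that a close stage exists even if the
  dyadic rational coded by \<open>m\<close> equals \<open>Theta V\<close> itself.\<close>
definition close_stage :: "nat \<Rightarrow> nat \<Rightarrow> bool" where
  "close_stage t m \<longleftrightarrow>
    code_value m * 2 ^ t < stage_mass f t * 2 ^ code_length m + 2 ^ t"

lemma close_stage_iff:
  "close_stage t m \<longleftrightarrow>
    real (code_value m) / 2 ^ code_length m < real (stage_mass f t) / 2 ^ t + (1/2) ^ code_length m"
proof -
  have "close_stage t m \<longleftrightarrow>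
      real (code_value m * 2 ^ t) < real (stage_mass f t * 2 ^ code_length m + 2 ^ t)"
    unfolding close_stage_def of_nat_less_iff ..
  also have "\<dots> \<longleftrightarrow> real (code_value m) * 2 ^ t <
      (real (stage_mass f t) / 2 ^ t + (1/2) ^ code_length m) * 2 ^ code_length m * 2 ^ t"
    by (simp add: distrib_right power_divide)
  also have "\<dots> \<longleftrightarrow> real (code_value m) <
      (real (stage_mass f t) / 2 ^ t + (1/2) ^ code_length m) * 2 ^ code_length m"
    by (rule mult_less_cancel_right_pos) simp
  also have "\<dots> \<longleftrightarrow> real (code_value m) / 2 ^ code_length m <
      real (stage_mass f t) / 2 ^ t + (1/2) ^ code_length m"
    by (rule pos_divide_less_eq[symmetric]) simp
  finally show ?thesis .
qed

lemma bits_Theta_bounds: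
  fixes n :: nat
  defines "m \<equiv> str_to_nat (bits (Theta V) n)"
  shows "code_length m = n" "real (code_value m) / 2 ^ n \<le> Theta V"
    "Theta V < real (code_value m) / 2 ^ n + (1/2) ^ n"
proof -
  show len: "code_length m = n" by (simp add: m_def bits_def)
  have "frac (Theta V) = Theta V" using Theta_bounds by (simp add: frac_eq)
  then have "int (code_value m) = \<lfloor>2 ^ n * Theta V\<rfloor>"
    using bits_value[where \<alpha> = "Theta V" and n = n] by (simp add: m_def code_value_str_to_nat bits_def)
  then have "real (code_value m) \<le> 2 ^ n * Theta V" "2 ^ n * Theta V < real (code_value m) + 1"
    by linarith+
  then show "real (code_value m) / 2 ^ n \<le> Theta V"
    "Theta V < real (code_value m) / 2 ^ n + (1/2) ^ n"
    by (auto simp: field_simps power_divide)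
qed

lemma ex_incompressible_selector:
  "\<exists>g. \<forall>n\<ge>1. \<exists>s. length s = n - 1 \<and> s \<notin> compressible \<and>
      eval g [str_to_nat (bits (Theta V) n)] (str_to_nat s)"
proof -
  have "comp_pred (Suc 1) (\<lambda>ys. close_stage (ys ! 0) (tl ys ! 0))"
    unfolding close_stage_def
    by (intro comp_fun_intros comp_fun_stage_mass comp_fun_code_length comp_fun_code_value) auto
  from ex_eval_Least[of 1 "\<lambda>t xs. close_stage t (xs ! 0)", OF this] obtain g1 where
    g1: "\<And>xs t. length xs = 1 \<Longrightarrow> close_stage t (xs ! 0) \<Longrightarrow> eval g1 xs (LEAST t. close_stage t (xs ! 0))"
    by blast
  \<comment> \<open>Given a stage \<open>t\<close>, the second search looks for a string one bit
    shorter than the input that is still missing.\<close>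
  define P where "P k t m \<longleftrightarrow> Suc (code_length k) = code_length m \<and> \<not> enumerated f t k" for k t m
  have "comp_pred (Suc 2) (\<lambda>ys. P (ys ! 0) (tl ys ! 0) (tl ys ! 1))"
    unfolding P_def
    by (intro comp_fun_intros comp_pred_enumerated comp_fun_code_length) auto
  from ex_eval_Least[of 2 "\<lambda>k xs. P k (xs ! 0) (xs ! 1)", OF this] obtain g2 where
    g2: "\<And>xs k. length xs = 2 \<Longrightarrow> P k (xs ! 0) (xs ! 1) \<Longrightarrow> eval g2 xs (LEAST k. P k (xs ! 0) (xs ! 1))"
    by blast
  have "\<exists>s. length s = n - 1 \<and> s \<notin> compressible \<and>
      eval (Comp g2 [g1, Proj 0]) [str_to_nat (bits (Theta V) n)] (str_to_nat s)" if "n \<ge> 1" for n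
  proof -
    define m where "m = str_to_nat (bits (Theta V) n)"
    note m = bits_Theta_bounds[of n, folded m_def]
    \<comment> \<open>Late stages come within \<open>(1/2) ^ n\<close> of \<open>Theta V\<close>,
      and the truncated value does not exceed \<open>Theta V\<close>, so the first search
      terminates.\<close>
    have "\<forall>\<^sub>F t in sequentially. Theta V - (1/2) ^ n < real (stage_mass f t) / 2 ^ t"
      using stage_mass_tendsto_Theta by (rule order_tendstoD) simp
    then obtain t0 where "Theta V - (1/2) ^ n < real (stage_mass f t0) / 2 ^ t0"
      using eventually_happens by force
    then have t0: "close_stage t0 m" using m by (simp add: close_stage_iff)
    define t where "t = (LEAST t. close_stage t m)"
    have t: "close_stage t m" unfolding t_def using t0 by (rule LeastI)
    \<comment> \<open>Truncation to \<open>n\<close> bits and the slack in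
      \<open>close_stage\<close> each cost \<open>(1/2) ^ n\<close>. Their sum is the weight of a
      string of length \<open>n - 1\<close>, which dictates the length of the output.\<close>
    have "(1/2::real) ^ n + (1/2) ^ n = (1/2) ^ (n - 1)"
      using that by (cases n) auto
    then have near: "Theta V < real (stage_mass f t) / 2 ^ t + (1/2) ^ (n - 1)"
      using t m by (simp add: close_stage_iff)
    \<comment> \<open>A truly incompressible string is never enumerated, so the second search
      terminates too.\<close>
    obtain s0 where s0: "length s0 = n - 1" "s0 \<notin> compressible" using ex_incompressible by blast
    then have P0: "P (str_to_nat s0) t m"
      using that m(1) enumerated_imp_compressible by (auto simp: P_def)
    define k where "k = (LEAST k. P k t m)"
    have k: "P k t m" unfolding k_def using P0 by (rule LeastI)
    obtain s where s: "str_to_nat s = k" using surj_str_to_nat by blast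
    have len: "length s = n - 1" using k s m(1) by (auto simp: P_def)
    \<comment> \<open>The search only ensures absence from stage \<open>t\<close>; closeness of that
      stage turns this into incompressibility.\<close>
    then have "s \<notin> compressible"
      using compressible_imp_enumerated[OF near] k s by (auto simp: P_def)
    moreover have "eval (Comp g2 [g1, Proj 0]) [m] k"
    proof (rule eval_Comp)
      show "list_all2 (\<lambda>g y. eval g [m] y) [g1, Proj 0] [t, m]"
        using g1[of "[m]"] t0 eval_Proj[of 0 "[m]"] by (simp add: t_def)
      show "eval g2 [t, m] k"
        using g2[of "[t, m]"] P0 unfolding k_def by simp
    qed
    ultimately show ?thesis using s len unfolding m_def by blast
  qed
  then show ?thesis by blast
qed

end

subsection \<open>Randomness\<close>

lemma ex_prefix_free_program:
  assumes "prefix_free_machine V"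
  obtains f where "prefix_free_program V f"
  using assms unfolding prefix_free_machine_def partial_recursive_str_def prefix_free_program_def
  by blast

lemma weakly_Chaitin_random_Theta:
  assumes U: "prefix_free_machine U" and V: "optimal_pfm V"
  shows "weakly_Chaitin_random U (Theta V)"
proof -
  from V obtain f where "prefix_free_program V f"
    unfolding optimal_pfm_def using ex_prefix_free_program by blast
  then interpret V: prefix_free_program V f .
  obtain u where u: "\<And>p s. U p = Some s \<longleftrightarrow> eval u [str_to_nat p] (str_to_nat s)"
    using U unfolding prefix_free_machine_def partial_recursive_str_def by blast
  obtain g where g: "\<And>n. n \<ge> 1 \<Longrightarrow> \<exists>s. length s = n - 1 \<and> s \<notin> V.compressible \<and>
      eval g [str_to_nat (bits (Theta V) n)] (str_to_nat s)"
    using V.ex_incompressible_selector by blast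
  \<comment> \<open>The machine \<open>C\<close> runs \<open>U\<close> and feeds the output to the
    selector; it halts only where \<open>U\<close> does and so inherits prefix-freeness.\<close>
  obtain C where C: "\<And>p s. C p = Some s \<longleftrightarrow> eval (Comp g [u]) [str_to_nat p] (str_to_nat s)"
    using ex_machine_of_recf by blast
  have dom: "dom C \<subseteq> dom U"
  proof
    fix p assume "p \<in> dom C"
    then obtain s where "eval (Comp g [u]) [str_to_nat p] (str_to_nat s)" using C by blast
    then obtain y where "eval u [str_to_nat p] y"
      by cases (auto simp: list_all2_Cons1)
    then show "p \<in> dom U" using u surj_str_to_nat by (metis domI)
  qed
  have "partial_recursive_str C"
    unfolding partial_recursive_str_def using C by (intro exI[of _ "Comp g [u]"]) simp
  moreover have "\<forall>p\<in>dom C. \<forall>q\<in>dom C. prefix p q \<longrightarrow> p = q"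
    using U dom unfolding prefix_free_machine_def by (meson subsetD)
  ultimately have "prefix_free_machine C" unfolding prefix_free_machine_def ..
  then obtain d where d: "\<And>p. p \<in> dom C \<Longrightarrow> \<exists>q\<in>dom V. V q = C p \<and> length q \<le> length p + d"
    using V unfolding optimal_pfm_def by blast
  \<comment> \<open>Optimality of \<open>V\<close> costs \<open>d\<close>, and the selected string
    is one bit shorter than the input, hence \<open>Suc d\<close>.\<close>
  have "enat n \<le> Hc U (bits (Theta V) n) + enat (Suc d)" if n: "n \<ge> 1" for n
  proof (rule ccontr)
    assume "\<not> ?thesis"
    then have "Hc U (bits (Theta V) n) < enat (n - Suc d)"
      by (cases "Hc U (bits (Theta V) n)") auto
    then obtain p where p: "U p = Some (bits (Theta V) n)" "length p < n - Suc d"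
      using Hc_less_iff by blast
    obtain s where s: "length s = n - 1" "s \<notin> V.compressible"
      "eval g [str_to_nat (bits (Theta V) n)] (str_to_nat s)"
      using g[OF n] by blast
    have "eval (Comp g [u]) [str_to_nat p] (str_to_nat s)"
      using p(1) s(3) u by (intro eval_Comp) auto
    then have Cp: "C p = Some s" using C by blast
    then obtain q where "V q = Some s" "length q \<le> length p + d" using d[of p] by auto
    \<comment> \<open>A program for \<open>s\<close> of length at most
      \<open>length p + d < n - 1\<close> would make \<open>s\<close> compressible.\<close>
    then show False using s(1,2) p(2) V.compressible_iff by fastforce
  qed
  then show ?thesis unfolding weakly_Chaitin_random_def by blast
qed

theorem theorem6:
  fixes U V :: "bool list \<Rightarrow> bool list option"
  assumes "optimal_pfm U" and "optimal_pfm V"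
  shows "left_computable (Theta V) \<and> weakly_Chaitin_random U (Theta V)"
proof
  obtain f where "prefix_free_program V f"
    using assms(2) ex_prefix_free_program unfolding optimal_pfm_def by blast
  then show "left_computable (Theta V)" by (rule prefix_free_program.left_computable_Theta)
  show "weakly_Chaitin_random U (Theta V)"
    using assms weakly_Chaitin_random_Theta unfolding optimal_pfm_def by blast
qed

end
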